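(* Let $k\in\mathbb N$, let $b_1,\dots,b_k>0$ with $\sum_{\ell=1}^kb_\ell=1$, let $\mathbf h=(h_{ij})_{i,j\in[k]}\in\mathbb R^{k\times k}$ and $\boldsymbol\alpha=(\alpha_{ij\ell})_{i,j,\ell\in[k]}\in\mathbb R^{k\times k\times k}$. Let $\sigma(x)=\frac{e^x}{1+e^x}$ for $x\in\mathbb R$, and define $S:[0,1]^{k\times k}\to(0,1)^{k\times k}$ componentwise, for $C=(c_{ij})_{i,j\in[k]}\in[0,1]^{k\times k}$, by $$(S(C))_{ij}=\sigma\Bigl(h_{ij}+\sum_{\ell=1}^kb_\ell\,c_{i\ell}c_{j\ell}\,\alpha_{ij\ell}\Bigr),\qquad i,j\in[k].$$ Then $S$ is globally Lipschitz on $[0,1]^{k\times k}$ with respect to $\|\cdot\|_\infty$, with Lipschitz constant $L:=\frac12\|\boldsymbol\alpha\|_\infty$, where $\|\boldsymbol\alpha\|_\infty=\max_{i,j,\ell\in[k]}|\alpha_{ij\ell}|$. If $L<1$ (i.e. if $\|\boldsymbol\alpha\|_\infty<2$), then $S$ is a contraction on $([0,1]^{k\times k},\|\cdot\|_\infty)$ and therefore admits a unique fixed point $C^\star\in[0,1]^{k\times k}$.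
   Context: $\|C\|_\infty=\max_{i,j\in[k]}|c_{ij}|$ for a matrix $C\in\mathbb R^{k\times k}$. "With Lipschitz constant $L$" means $\|S(C)-S(\widehat C)\|_\infty\le L\|C-\widehat C\|_\infty$ for all $C,\widehat C$. *)

theory Defs
  imports "HOL-Analysis.Analysis"
begin

text \<open>The index set \<open>[k]\<close> is a finite type \<open>'k\<close>, so that \<open>k = CARD('k)\<close>.\<close>

definition logistic :: "real \<Rightarrow> real"
  where "logistic x = exp x / (1 + exp x)"

text \<open>
  The norms below are entrywise maximum norms. The norms and distances that the library
  provides on \<open>real ^ 'k ^ 'k\<close> are the Euclidean ones, hence \<open>lipschitz_on\<close>
  cannot be used here.
\<close>

definition matrix_max_norm :: "real ^ 'k ^ 'k \<Rightarrow> real"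
  where "matrix_max_norm C = Max (range (\<lambda>(i, j). \<bar>C $ i $ j\<bar>))"

definition tensor_max_norm :: "real ^ 'k ^ 'k ^ 'k \<Rightarrow> real"
  where "tensor_max_norm A = Max (range (\<lambda>(i, j, l). \<bar>A $ i $ j $ l\<bar>))"

definition closed_unit_matrices :: "(real ^ 'k ^ 'k) set"
  where "closed_unit_matrices = {C. \<forall>i j. C $ i $ j \<in> {0..1}}"

definition open_unit_matrices :: "(real ^ 'k ^ 'k) set"
  where "open_unit_matrices = {C. \<forall>i j. C $ i $ j \<in> {0<..<1}}"

definition S_map ::
    "real ^ 'k \<Rightarrow> real ^ 'k ^ 'k \<Rightarrow> real ^ 'k ^ 'k ^ 'k \<Rightarrow> real ^ 'k ^ 'k \<Rightarrow> real ^ 'k ^ 'k"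
  where "S_map b h \<alpha> C =
    (\<chi> i j. logistic (h $ i $ j + (\<Sum>l\<in>UNIV. b $ l * C $ i $ l * C $ j $ l * \<alpha> $ i $ j $ l)))"

definition max_norm_lipschitz_on ::
    "real \<Rightarrow> (real ^ 'k ^ 'k) set \<Rightarrow> (real ^ 'k ^ 'k \<Rightarrow> real ^ 'k ^ 'k) \<Rightarrow> bool"
  where "max_norm_lipschitz_on L X f \<longleftrightarrow> 0 \<le> L \<and>
    (\<forall>C\<in>X. \<forall>D\<in>X. matrix_max_norm (f C - f D) \<le> L * matrix_max_norm (C - D))"

definition max_norm_contraction_on ::
    "(real ^ 'k ^ 'k) set \<Rightarrow> (real ^ 'k ^ 'k \<Rightarrow> real ^ 'k ^ 'k) \<Rightarrow> bool"
  where "max_norm_contraction_on X f \<longleftrightarrow>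
    f ` X \<subseteq> X \<and> (\<exists>q<1. max_norm_lipschitz_on q X f)"

end

theory Submission
  imports Defs
begin

text \<open>
  The logistic function has derivative \<open>\<sigma> (1 - \<sigma>) \<le> 1/4\<close>, and for
  entries in \<open>[0,1]\<close> each product \<open>c\<^sub>i\<^sub>l c\<^sub>j\<^sub>l\<close> changes by at most twice the distance of
  the matrices; averaging with the weights \<open>b\<close> gives the constant
  \<open>2 \<cdot> 1/4 = 1/2\<close>. The cube is compact, so instead of iterating \<open>S\<close> one can minimise the
  displacement of \<open>S C\<close> from \<open>C\<close>: a contraction strictly decreases every nonzero displacement,
  hence the minimum is zero.
\<close>

lemma logistic_in_unit_interval: "logistic x \<in> {0<..<1}"
  by (simp add: logistic_def add_pos_pos)

lemma has_real_derivative_logistic: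
  "(logistic has_real_derivative exp x / (1 + exp x)\<^sup>2) (at x)"
proof -
  have "1 + exp x \<noteq> 0"
    by (metis add_pos_pos exp_gt_zero less_irrefl zero_less_one)
  then show ?thesis
    unfolding logistic_def [abs_def]
    by (auto intro!: derivative_eq_intros simp: power2_eq_square algebra_simps)
qed

lemma logistic_lipschitz: "\<bar>logistic x - logistic y\<bar> \<le> \<bar>x - y\<bar> / 4"
proof -
  have "norm (exp z / (1 + exp z)\<^sup>2) \<le> 1 / 4" for z :: real
  proof -
    \<comment> \<open>This is \<open>0 \<le> (1 - exp z)\<^sup>2\<close> rearranged, with equality
      at \<open>z = 0\<close>; hence the constant 1/4.\<close>
    have "4 * exp z \<le> (1 + exp z)\<^sup>2"
      using zero_le_power2 [of "1 - exp z"] by (simp add: power2_eq_square algebra_simps)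
    moreover have "0 < (1 + exp z)\<^sup>2"
      by (intro zero_less_power add_pos_pos) auto
    ultimately show ?thesis
      by (simp add: pos_divide_le_eq)
  qed
  then have "norm (logistic x - logistic y) \<le> 1 / 4 * norm (x - y)"
    by (intro field_differentiable_bound [of UNIV]) (auto intro: has_real_derivative_logistic)
  then show ?thesis
    by simp
qed

lemma matrix_max_norm_le_iff: "matrix_max_norm C \<le> r \<longleftrightarrow> (\<forall>i j. \<bar>C $ i $ j\<bar> \<le> r)"
  unfolding matrix_max_norm_def by (subst Max_le_iff) auto

lemma abs_entry_le_matrix_max_norm: "\<bar>C $ i $ j\<bar> \<le> matrix_max_norm C"
  using matrix_max_norm_le_iff by blast

lemma matrix_max_norm_nonneg: "0 \<le> matrix_max_norm C"
  by (rule order_trans [OF abs_ge_zero abs_entry_le_matrix_max_norm])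

lemma matrix_max_norm_eq_0_iff: "matrix_max_norm C = 0 \<longleftrightarrow> C = 0"
  using matrix_max_norm_le_iff [of C 0] matrix_max_norm_nonneg [of C]
  by (auto simp: vec_eq_iff)

lemma matrix_max_norm_minus: "matrix_max_norm (- C) = matrix_max_norm C"
  by (simp add: matrix_max_norm_def)

lemma matrix_max_norm_triangle_ineq:
  "matrix_max_norm (C + D) \<le> matrix_max_norm C + matrix_max_norm D"
  unfolding matrix_max_norm_le_iff
  by (auto intro!: order_trans [OF abs_triangle_ineq] add_mono abs_entry_le_matrix_max_norm)

text \<open>Links the maximum norm to the Euclidean norm, which underlies \<open>compact\<close> and
  \<open>continuous_on\<close>. This direction suffices to turn maximum norm estimates into
  continuity.\<close>

lemma matrix_max_norm_le_norm: "matrix_max_norm C \<le> norm C"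
  unfolding matrix_max_norm_le_iff
  by (intro allI order_trans [OF component_le_norm_cart Finite_Cartesian_Product.norm_nth_le])

lemma abs_entry_le_tensor_max_norm: "\<bar>A $ i $ j $ l\<bar> \<le> tensor_max_norm A"
  unfolding tensor_max_norm_def by (rule Max_ge) (auto intro: rev_image_eqI [of "(i, j, l)"])

lemma tensor_max_norm_nonneg: "0 \<le> tensor_max_norm A"
  by (rule order_trans [OF abs_ge_zero abs_entry_le_tensor_max_norm])

lemma compact_closed_unit_matrices: "compact closed_unit_matrices"
proof -
  \<comment> \<open>The order on vectors is componentwise, so the cube is an order interval, and
    such intervals are compact boxes.\<close>
  have "closed_unit_matrices = {0 .. (\<chi> i j. 1)}"
    by (auto simp: closed_unit_matrices_def less_eq_vec_def)
  then show ?thesis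
    by (metis compact_cbox interval_cbox)
qed

lemma zero_in_closed_unit_matrices: "0 \<in> closed_unit_matrices"
  by (simp add: closed_unit_matrices_def)

text \<open>Go from \<open>f C\<close> to \<open>C\<close> via \<open>f D\<close> and
  \<open>D\<close>. The middle leg is the displacement at \<open>D\<close>; each outer leg costs at
  most \<open>norm (C - D)\<close>, hence the factor 2. The bound serves to make the displacement
  continuous.\<close>

lemma displacement_diff_le:
  assumes "max_norm_lipschitz_on q X f" "q \<le> 1" "C \<in> X" "D \<in> X"
  shows "matrix_max_norm (f C - C) - matrix_max_norm (f D - D) \<le> 2 * norm (C - D)"
proof -
  have "matrix_max_norm (f C - f D) \<le> q * matrix_max_norm (C - D)"
    using assms by (simp add: max_norm_lipschitz_on_def)
  also have "\<dots> \<le> matrix_max_norm (C - D)"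
    using mult_right_mono [OF \<open>q \<le> 1\<close> matrix_max_norm_nonneg] by simp
  finally have "matrix_max_norm (f C - f D) \<le> matrix_max_norm (C - D)" .
  moreover have "matrix_max_norm (f C - C)
      \<le> matrix_max_norm (f C - f D) + (matrix_max_norm (f D - D) + matrix_max_norm (D - C))"
    using matrix_max_norm_triangle_ineq [of "f C - f D" "(f D - D) + (D - C)"]
      matrix_max_norm_triangle_ineq [of "f D - D" "D - C"]
    by simp
  moreover have "matrix_max_norm (D - C) = matrix_max_norm (C - D)"
    using matrix_max_norm_minus [of "C - D"] by simp
  ultimately show ?thesis
    using matrix_max_norm_le_norm [of "C - D"] by linarith
qed

lemma max_norm_contraction_unique_fixed_point:
  assumes "max_norm_contraction_on X f" "compact X" "X \<noteq> {}"
  shows "\<exists>!C. C \<in> X \<and> f C = C"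
proof -
  from assms(1) obtain q
    where maps: "f ` X \<subseteq> X" and "q < 1" and lip: "max_norm_lipschitz_on q X f"
    by (auto simp: max_norm_contraction_on_def)
  have shrink: "matrix_max_norm (f C - f D) < matrix_max_norm (C - D)"
    if "C \<in> X" "D \<in> X" "C \<noteq> D" for C D
  proof -
    have "matrix_max_norm (f C - f D) \<le> q * matrix_max_norm (C - D)"
      using lip that by (simp add: max_norm_lipschitz_on_def)
    \<comment> \<open>Strictness comes from \<open>C \<noteq> D\<close>, which makes the norm
      positive.\<close>
    also have "\<dots> < matrix_max_norm (C - D)"
      using \<open>q < 1\<close> that matrix_max_norm_nonneg [of "C - D"] matrix_max_norm_eq_0_iff [of "C - D"]
      by auto
    finally show ?thesis .
  qed
  let ?d = "\<lambda>C. matrix_max_norm (f C - C)"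
  have "2-lipschitz_on X ?d"
  proof (rule lipschitz_onI)
    fix C D assume "C \<in> X" "D \<in> X"
    \<comment> \<open>The one-sided estimate is applied in both orders of \<open>C\<close> and
      \<open>D\<close> to bound the absolute value.\<close>
    then show "dist (?d C) (?d D) \<le> 2 * dist C D"
      using displacement_diff_le [OF lip, of C D] displacement_diff_le [OF lip, of D C] \<open>q < 1\<close>
      by (simp add: dist_norm abs_le_iff norm_minus_commute)
  qed simp
  then have "continuous_on X ?d"
    by (rule lipschitz_on_continuous_on)
  then obtain C where "C \<in> X" and min: "\<And>D. D \<in> X \<Longrightarrow> ?d C \<le> ?d D"
    using continuous_attains_inf [OF assms(2,3)] by blast
  have "f C = C"
  proof (rule ccontr)
    assume "f C \<noteq> C"
    \<comment> \<open>The displacement at \<open>f C\<close> is the distance between the images of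
      \<open>f C\<close> and \<open>C\<close>, so moving to \<open>f C\<close> would beat the
      minimum.\<close>
    then have "?d (f C) < ?d C"
      using shrink [of "f C" C] maps \<open>C \<in> X\<close> by blast
    then show False
      using min [of "f C"] maps \<open>C \<in> X\<close> by fastforce
  qed
  moreover have "D = C" if "D \<in> X" "f D = D" for D
    using shrink [of D C] that \<open>C \<in> X\<close> \<open>f C = C\<close> by fastforce
  ultimately show ?thesis
    using \<open>C \<in> X\<close> by blast
qed

lemma S_map_in_open_unit_matrices: "S_map b h \<alpha> C \<in> open_unit_matrices"
  using logistic_in_unit_interval by (simp add: open_unit_matrices_def S_map_def)

text \<open>Change one factor at a time: each of the two resulting terms is a difference of entries
  times an entry of absolute value at most 1.\<close>

lemma entry_product_diff_le:
  assumes "C \<in> closed_unit_matrices" "D \<in> closed_unit_matrices"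
  shows "\<bar>C $ i $ l * C $ j $ l - D $ i $ l * D $ j $ l\<bar> \<le> 2 * matrix_max_norm (C - D)"
proof -
  have entry: "\<bar>C $ i $ l\<bar> \<le> 1" "\<bar>D $ j $ l\<bar> \<le> 1"
    using assms by (auto simp: closed_unit_matrices_def)
  have diff: "\<bar>C $ m $ l - D $ m $ l\<bar> \<le> matrix_max_norm (C - D)" for m
    using abs_entry_le_matrix_max_norm [of "C - D" m l] by simp
  have "C $ i $ l * C $ j $ l - D $ i $ l * D $ j $ l
      = C $ i $ l * (C $ j $ l - D $ j $ l) + (C $ i $ l - D $ i $ l) * D $ j $ l"
    by (simp add: algebra_simps)
  also have "\<bar>\<dots>\<bar> \<le> \<bar>C $ i $ l\<bar> * \<bar>C $ j $ l - D $ j $ l\<bar> + \<bar>C $ i $ l - D $ i $ l\<bar> * \<bar>D $ j $ l\<bar>"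
    by (rule order_trans [OF abs_triangle_ineq]) (simp add: abs_mult)
  also have "\<dots> \<le> 1 * matrix_max_norm (C - D) + matrix_max_norm (C - D) * 1"
    using entry diff by (intro add_mono mult_mono) (auto simp: matrix_max_norm_nonneg)
  finally show ?thesis
    by simp
qed

lemma S_map_lipschitz:
  fixes b :: "real ^ 'k" and h :: "real ^ 'k ^ 'k" and \<alpha> :: "real ^ 'k ^ 'k ^ 'k"
  assumes b_nonneg: "\<And>l. b $ l \<ge> 0" and b_sum: "(\<Sum>l\<in>UNIV. b $ l) = 1"
  shows "max_norm_lipschitz_on (1 / 2 * tensor_max_norm \<alpha>) closed_unit_matrices (S_map b h \<alpha>)"
proof -
  have "\<bar>(S_map b h \<alpha> C - S_map b h \<alpha> D) $ i $ j\<bar> \<le> 1 / 2 * tensor_max_norm \<alpha> * matrix_max_norm (C - D)"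
    if CD: "C \<in> closed_unit_matrices" "D \<in> closed_unit_matrices" for C D i j
  proof -
    let ?M = "2 * matrix_max_norm (C - D) * tensor_max_norm \<alpha>"
    let ?s = "\<lambda>C :: real ^ 'k ^ 'k. \<Sum>l\<in>UNIV. b $ l * C $ i $ l * C $ j $ l * \<alpha> $ i $ j $ l"
    have diff: "?s C - ?s D
        = (\<Sum>l\<in>UNIV. b $ l * ((C $ i $ l * C $ j $ l - D $ i $ l * D $ j $ l) * \<alpha> $ i $ j $ l))"
      by (simp add: sum_subtractf [symmetric] algebra_simps)
    have "\<bar>?s C - ?s D\<bar>
        \<le> (\<Sum>l\<in>UNIV. \<bar>b $ l * ((C $ i $ l * C $ j $ l - D $ i $ l * D $ j $ l) * \<alpha> $ i $ j $ l)\<bar>)"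
      unfolding diff by (rule sum_abs)
    also have "\<dots> \<le> (\<Sum>l\<in>UNIV. b $ l * ?M)"
    proof (rule sum_mono)
      fix l
      have "\<bar>C $ i $ l * C $ j $ l - D $ i $ l * D $ j $ l\<bar> * \<bar>\<alpha> $ i $ j $ l\<bar> \<le> ?M"
        by (rule mult_mono [OF entry_product_diff_le [OF CD] abs_entry_le_tensor_max_norm])
          (simp_all add: matrix_max_norm_nonneg)
      then have "b $ l * \<bar>(C $ i $ l * C $ j $ l - D $ i $ l * D $ j $ l) * \<alpha> $ i $ j $ l\<bar> \<le> b $ l * ?M"
        unfolding abs_mult by (rule mult_left_mono [OF _ b_nonneg])
      then show "\<bar>b $ l * ((C $ i $ l * C $ j $ l - D $ i $ l * D $ j $ l) * \<alpha> $ i $ j $ l)\<bar> \<le> b $ l * ?M"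
        by (simp only: abs_mult [of "b $ l"] abs_of_nonneg [OF b_nonneg])
    qed
    \<comment> \<open>The weights sum to 1, so the bound does not grow with the number of
      indices.\<close>
    also have "\<dots> = ?M"
      by (simp add: sum_distrib_right [symmetric] b_sum)
    finally have "\<bar>?s C - ?s D\<bar> \<le> ?M" .
    \<comment> \<open>The shift \<open>h $ i $ j\<close> cancels in the difference of the arguments,
      and the logistic factor 1/4 turns the 2 in \<open>?M\<close> into 1/2.\<close>
    then show ?thesis
      using logistic_lipschitz [of "h $ i $ j + ?s C" "h $ i $ j + ?s D"]
      by (simp add: S_map_def algebra_simps)
  qed
  then show ?thesis
    unfolding max_norm_lipschitz_on_def matrix_max_norm_le_iff
    by (simp add: tensor_max_norm_nonneg)
qed

theorem theorem2p15:
  fixes b :: "real ^ 'k" and h :: "real ^ 'k ^ 'k" and \<alpha> :: "real ^ 'k ^ 'k ^ 'k"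
  assumes b_pos: "\<And>l. b $ l > 0"
    and b_sum: "(\<Sum>l\<in>UNIV. b $ l) = 1"
  shows "S_map b h \<alpha> ` closed_unit_matrices \<subseteq> open_unit_matrices
    \<and> max_norm_lipschitz_on (1 / 2 * tensor_max_norm \<alpha>) closed_unit_matrices (S_map b h \<alpha>)
    \<and> (1 / 2 * tensor_max_norm \<alpha> < 1 \<longleftrightarrow> tensor_max_norm \<alpha> < 2)
    \<and> (1 / 2 * tensor_max_norm \<alpha> < 1 \<longrightarrow>
          max_norm_contraction_on closed_unit_matrices (S_map b h \<alpha>)
        \<and> (\<exists>!C. C \<in> closed_unit_matrices \<and> S_map b h \<alpha> C = C))"
proof -
  have maps: "S_map b h \<alpha> ` closed_unit_matrices \<subseteq> open_unit_matrices"
    using S_map_in_open_unit_matrices by blast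
  moreover have lip:
    "max_norm_lipschitz_on (1 / 2 * tensor_max_norm \<alpha>) closed_unit_matrices (S_map b h \<alpha>)"
    using b_pos b_sum by (intro S_map_lipschitz) (auto intro: less_imp_le)
  moreover have "max_norm_contraction_on closed_unit_matrices (S_map b h \<alpha>)"
    if "1 / 2 * tensor_max_norm \<alpha> < 1"
  proof -
    \<comment> \<open>A contraction has to map the closed cube into itself; landing in the open cube
      is enough.\<close>
    have "open_unit_matrices \<subseteq> (closed_unit_matrices :: (real ^ 'k ^ 'k) set)"
      by (auto simp: open_unit_matrices_def closed_unit_matrices_def less_imp_le)
    then show ?thesis
      using maps lip that unfolding max_norm_contraction_on_def by blast
  qed
  moreover have "\<exists>!C. C \<in> closed_unit_matrices \<and> S_map b h \<alpha> C = C"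
    if "max_norm_contraction_on closed_unit_matrices (S_map b h \<alpha>)"
    \<comment> \<open>The zero matrix witnesses that the cube is nonempty, so that a minimum
      exists.\<close>
    using that compact_closed_unit_matrices zero_in_closed_unit_matrices
    by (intro max_norm_contraction_unique_fixed_point) auto
  ultimately show ?thesis
    by simp
qed

end
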